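(* Let $X$ be a compact metric space and let $\{f_i\}_{i\in I}$ be an autonomous IFS on $X$ ($I$ finite) which is post-critically countable, and suppose that $f_i$ is injective for every $i\in I$. Let $\mu$ be a probability measure on the set of all non-empty subsets of $I$ such that $\mu(\{I'\subset I : i\notin I'\})>0$ for every $i\in I$, and let $(I^{(j)})_{j\ge 1}$ be an i.i.d. sequence of non-empty subsets of $I$ with common law $\mu$. Then, almost surely, the limit set of the non-autonomous IFS $(\{f_i\}_{i\in I^{(j)}})_{j=1}^\infty$ is totally disconnected.
   Context: Let $X$ be a non-empty compact metric space; $\mathrm{Lip}(f)$ denotes the Lipschitz constant of $f\colon X\to X$. A non-autonomous IFS $(\Phi^{(j)})_{j\ge1}$ on $X$ is a sequence of collections $\Phi^{(j)}=\{f^{(j)}_i\colon X\to X\}_{i\in I^{(j)}}$ of maps, with each index set $I^{(j)}$ finite and non-empty, such that there is a constant $c<1$ with $\mathrm{Lip}(f^{(j)}_i)\le c$ for all $j\ge1$, $i\in I^{(j)}$. Its coding map $\Pi\colon\prod_{j\ge1}I^{(j)}\to X$ is defined by $\{\Pi(i_1,i_2,\dots)\}=\bigcap_{j\ge1}f^{(1)}_{i_1}\circ\cdots\circ f^{(j)}_{i_j}(X)$, and its limit set is the image $\Pi(\prod_{j\ge1}I^{(j)})$. An autonomous IFS $\{f_i\}_{i\in I}$ is one with $\Phi^{(j)}=\{f_i\}_{i\in I}$ for every $j\ge 1$; let $J$ be its limit set and $\Pi\colon\prod_{j\ge1}I\to J$ its coding map. Its critical set is $C=\bigcup_{i\ne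 i'\in I}(f_i(J)\cap f_{i'}(J))$, and its post-critical set is $\bigcup_{n\ge1}\sigma^n(\Pi^{-1}(C))$, where $\sigma\colon\prod_{j\ge1}I\to\prod_{j\ge1}I$ is the left shift. The autonomous IFS is post-critically countable if its post-critical set is at most countable. *)

theory Defs
  imports "HOL-Analysis.Analysis" "HOL-Probability.Probability"
begin

(* The compact metric space is a subset X of a metric-space type and maps X -> X are total
   functions whose values outside X are irrelevant. Sequences indexed by j >= 1 in the
   mathematics are indexed by nat from 0 here, so position j stands for level j + 1. *)

definition nonautonomous_ifs ::
  "'a::metric_space set \<Rightarrow> (nat \<Rightarrow> 'i set) \<Rightarrow> (nat \<Rightarrow> 'i \<Rightarrow> 'a \<Rightarrow> 'a) \<Rightarrow> bool" where
  "nonautonomous_ifs X I f \<longleftrightarrow>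
     (\<forall>j. finite (I j) \<and> I j \<noteq> {}) \<and>
     (\<forall>j. \<forall>i\<in>I j. f j i \<in> X \<rightarrow> X) \<and>
     (\<exists>c<1. \<forall>j. \<forall>i\<in>I j. c-lipschitz_on X (f j i))"

primrec word_map :: "(nat \<Rightarrow> 'i \<Rightarrow> 'a \<Rightarrow> 'a) \<Rightarrow> (nat \<Rightarrow> 'i) \<Rightarrow> nat \<Rightarrow> 'a \<Rightarrow> 'a" where
  "word_map f u 0 = id"
| "word_map f u (Suc n) = word_map f u n \<circ> f n (u n)"

(* Meaningful when the intersection is a singleton, in particular for the codes of a
   non-autonomous IFS on a non-empty compact X. *)
definition coding_map ::
  "'a set \<Rightarrow> (nat \<Rightarrow> 'i \<Rightarrow> 'a \<Rightarrow> 'a) \<Rightarrow> (nat \<Rightarrow> 'i) \<Rightarrow> 'a" where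
  "coding_map X f u = (THE x. {x} = (\<Inter>n\<in>{1..}. word_map f u n ` X))"

definition limit_set ::
  "'a set \<Rightarrow> (nat \<Rightarrow> 'i set) \<Rightarrow> (nat \<Rightarrow> 'i \<Rightarrow> 'a \<Rightarrow> 'a) \<Rightarrow> 'a set" where
  "limit_set X I f = coding_map X f ` (\<Pi> j\<in>UNIV. I j)"

definition autonomous_ifs :: "'a::metric_space set \<Rightarrow> 'i set \<Rightarrow> ('i \<Rightarrow> 'a \<Rightarrow> 'a) \<Rightarrow> bool" where
  "autonomous_ifs X I f \<longleftrightarrow> nonautonomous_ifs X (\<lambda>_. I) (\<lambda>_. f)"

definition critical_set :: "'a set \<Rightarrow> 'i set \<Rightarrow> ('i \<Rightarrow> 'a \<Rightarrow> 'a) \<Rightarrow> 'a set" where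
  "critical_set X I f =
     (let J = limit_set X (\<lambda>_. I) (\<lambda>_. f)
      in \<Union>i\<in>I. \<Union>i'\<in>I - {i}. f i ` J \<inter> f i' ` J)"

definition left_shift :: "(nat \<Rightarrow> 'i) \<Rightarrow> nat \<Rightarrow> 'i" where
  "left_shift u = (\<lambda>n. u (Suc n))"

definition post_critical_set :: "'a set \<Rightarrow> 'i set \<Rightarrow> ('i \<Rightarrow> 'a \<Rightarrow> 'a) \<Rightarrow> (nat \<Rightarrow> 'i) set" where
  "post_critical_set X I f =
     (\<Union>n\<in>{1..}. (left_shift ^^ n) `
        {u \<in> UNIV \<rightarrow> I. coding_map X (\<lambda>_. f) u \<in> critical_set X I f})"

definition post_critically_countable :: "'a set \<Rightarrow> 'i set \<Rightarrow> ('i \<Rightarrow> 'a \<Rightarrow> 'a) \<Rightarrow> bool" where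
  "post_critically_countable X I f \<longleftrightarrow> countable (post_critical_set X I f)"

definition totally_disconnected :: "'a::topological_space set \<Rightarrow> bool" where
  "totally_disconnected S \<longleftrightarrow> (\<forall>x\<in>S. connected_component_set S x = {x})"

end

theory Submission
  imports Defs
begin

text \<open>
  Write \<open>\<Pi>\<close> for the coding map of the autonomous system, \<open>\<sigma>\<close> for the left shift, \<open>P\<close> for the
  countable post-critical set and \<open>R j\<close> for the random sets of indices. The random limit set is the
  image of \<open>\<Prod>j. R j\<close> under \<open>\<Pi>\<close>.

  A fixed code \<open>p\<close> and a fixed \<open>k\<close> satisfy \<open>p j \<in> R (j + k)\<close> for all \<open>j\<close> only with probability \<open>0\<close>,
  because by independence the first \<open>n\<close> of these events hold together with probability at most
  \<open>q ^ n\<close>, where \<open>q < 1\<close> is the largest of the finitely many probabilities that a random set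
  contains a given index. Since \<open>P\<close> is countable, almost surely this fails for all \<open>p \<in> P\<close> and all
  \<open>k\<close> at once: no tail \<open>\<Prod>j. R (j + k)\<close> contains a post-critical code.

  On this event \<open>\<Pi>\<close> is injective on \<open>\<Prod>j. R j\<close>. For if \<open>\<Pi> u = \<Pi> v\<close> and \<open>n\<close> is the first position
  at which \<open>u\<close> and \<open>v\<close> differ, then \<open>\<Pi> (\<sigma>\<^sup>n u) = \<Pi> (\<sigma>\<^sup>n v)\<close> because the maps are injective, and this
  point is critical because the two codes start with different indices. So \<open>\<sigma> (\<sigma>\<^sup>n u)\<close> is a
  post-critical code, and it lies in the tail \<open>\<Prod>j. R (j + n + 1)\<close>, a contradiction.

  Finally, \<open>\<Pi>\<close> is continuous for the product topology, so that it sends products of subsets of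
  the finite set of indices to compact sets. When \<open>\<Pi>\<close> is injective on such a product, two points of
  the image whose codes differ at position \<open>n\<close> are separated by the images of the codes that agree,
  respectively disagree, with the first of them at \<open>n\<close>: these are disjoint compact sets that
  cover the image.
\<close>

section \<open>The coding map of a contracting system\<close>

lemma funpow_left_shift: "(left_shift ^^ n) w j = w (j + n)"
  by (induction n arbitrary: j) (auto simp: left_shift_def)

text \<open>
  An autonomous system whose contraction ratio \<open>c\<close> is fixed. The index set may be empty.
\<close>

locale contracting_ifs =
  fixes X :: "'a::metric_space set" and I :: "'i set" and f :: "'i \<Rightarrow> 'a \<Rightarrow> 'a" and c :: real
  assumes compact_X: "compact X" and X_nonempty: "X \<noteq> {}"
    and finite_I: "finite I"
    and maps_X: "\<And>i. i \<in> I \<Longrightarrow> f i \<in> X \<rightarrow> X"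
    and c_nonneg: "0 \<le> c" and c_less_1: "c < 1"
    and lipschitz: "\<And>i. i \<in> I \<Longrightarrow> c-lipschitz_on X (f i)"
begin

text \<open>The composition \<open>f (u 0) \<circ> \<dots> \<circ> f (u (n - 1))\<close> along the first \<open>n\<close> indices of the code \<open>u\<close>.\<close>

abbreviation words :: "(nat \<Rightarrow> 'i) \<Rightarrow> nat \<Rightarrow> 'a \<Rightarrow> 'a" where
  "words \<equiv> word_map (\<lambda>_. f)"

abbreviation coding :: "(nat \<Rightarrow> 'i) \<Rightarrow> 'a" where
  "coding \<equiv> coding_map X (\<lambda>_. f)"

lemma words_mem:
  assumes "u \<in> UNIV \<rightarrow> I" "x \<in> X"
  shows "words u n x \<in> X"
  using assms
proof (induction n arbitrary: x)
  case (Suc n)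
  then show ?case using maps_X[of "u n"] by (auto simp: Pi_iff)
qed simp

lemma words_lipschitz:
  assumes "u \<in> UNIV \<rightarrow> I"
  shows "(c ^ n)-lipschitz_on X (words u n)"
proof (induction n)
  case 0
  show ?case by (auto intro!: lipschitz_onI)
next
  case (Suc n)
  have i: "u n \<in> I" using assms by auto
  have "f (u n) ` X \<subseteq> X" using maps_X[OF i] by auto
  then have "(c ^ n)-lipschitz_on (f (u n) ` X) (words u n)"
    using Suc lipschitz_on_subset by blast
  from lipschitz_on_compose[OF lipschitz[OF i] this] show ?case
    by (simp add: mult.commute)
qed

text \<open>
  The composition along a code extends on the right by definition. Extending it on the left
  relates the code to its shift.
\<close>

lemma words_Suc_left: "words u (Suc n) = f (u 0) \<circ> words (left_shift u) n"
proof (induction n)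
  case (Suc n)
  have "words u (Suc (Suc n)) = words u (Suc n) \<circ> f (u (Suc n))" by simp
  also have "\<dots> = f (u 0) \<circ> words (left_shift u) n \<circ> f (left_shift u n)"
    by (simp only: Suc left_shift_def)
  finally show ?case by (simp add: comp_assoc)
qed simp

lemma words_cong: "(\<And>j. j < n \<Longrightarrow> u j = v j) \<Longrightarrow> words u n = words v n"
  by (induction n) simp_all

lemma dist_words_image:
  assumes "u \<in> UNIV \<rightarrow> I" "x \<in> words u n ` X" "y \<in> words u n ` X"
  shows "dist x y \<le> c ^ n * diameter X"
proof -
  obtain a b where ab: "a \<in> X" "b \<in> X" "x = words u n a" "y = words u n b"
    using assms by auto
  have "dist x y \<le> c ^ n * dist a b"
    using lipschitz_onD[OF words_lipschitz[OF assms(1)] ab(1,2)] ab by simp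
  also have "\<dots> \<le> c ^ n * diameter X"
    using ab(1,2) c_nonneg compact_imp_bounded[OF compact_X]
    by (intro mult_left_mono diameter_bounded_bound) auto
  finally show ?thesis .
qed

lemma cylinder_diameter_tendsto_0: "(\<lambda>n. c ^ n * diameter X) \<longlonglongrightarrow> 0"
  using tendsto_mult_left_zero[OF LIMSEQ_power_zero[of c]] c_nonneg c_less_1 by simp

lemma words_image_decseq:
  assumes "u \<in> UNIV \<rightarrow> I"
  shows "decseq (\<lambda>n. words u n ` X)"
proof (rule decseq_SucI)
  fix n
  have "f (u n) ` X \<subseteq> X" using maps_X[of "u n"] assms by auto
  then show "words u (Suc n) ` X \<subseteq> words u n ` X" by auto
qed

lemma words_image_Inter_unique:
  assumes "u \<in> UNIV \<rightarrow> I"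
    and "\<And>n. n \<ge> 1 \<Longrightarrow> x \<in> words u n ` X" "\<And>n. n \<ge> 1 \<Longrightarrow> y \<in> words u n ` X"
  shows "x = y"
proof -
  have "dist x y \<le> 0"
    by (rule LIMSEQ_le_const[OF cylinder_diameter_tendsto_0])
      (use dist_words_image[OF assms(1) assms(2,3)] in blast)
  then show ?thesis by simp
qed

lemma words_image_Inter_nonempty:
  assumes "u \<in> UNIV \<rightarrow> I"
  shows "(\<Inter>n. words u n ` X) \<noteq> {}"
proof (rule compact_space_imp_nest[of "top_of_set X"])
  show "compact_space (top_of_set X)" using compact_X by (simp add: compact_space_subtopology)
  show "closedin (top_of_set X) (words u n ` X)" for n
  proof (rule closed_subset)
    show "words u n ` X \<subseteq> X" using words_mem[OF assms] by auto
    show "closed (words u n ` X)"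
      using lipschitz_on_continuous_on[OF words_lipschitz[OF assms]] compact_X
      by (intro compact_imp_closed compact_continuous_image)
  qed
  show "words u n ` X \<noteq> {}" for n using X_nonempty by simp
  show "decseq (\<lambda>n. words u n ` X)" by (rule words_image_decseq[OF assms])
qed

lemma coding_equality:
  assumes "u \<in> UNIV \<rightarrow> I" and "\<And>n. n \<ge> 1 \<Longrightarrow> x \<in> words u n ` X"
  shows "coding u = x"
proof -
  have eq: "(\<Inter>n\<in>{1..}. words u n ` X) = {x}"
    using assms words_image_Inter_unique[OF assms(1)] by (fastforce simp del: image_iff)
  show ?thesis unfolding coding_map_def eq by (rule the_equality) auto
qed

lemma coding_mem_words_image:
  assumes "u \<in> UNIV \<rightarrow> I"
  shows "coding u \<in> words u n ` X"
proof -
  obtain x where x: "\<And>n. x \<in> words u n ` X" using words_image_Inter_nonempty[OF assms] by auto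
  then show ?thesis using coding_equality[OF assms, of x] by blast
qed

lemma coding_mem: "u \<in> UNIV \<rightarrow> I \<Longrightarrow> coding u \<in> X"
  using coding_mem_words_image[of u 0] by simp

lemma left_shift_mem: "u \<in> UNIV \<rightarrow> I \<Longrightarrow> left_shift u \<in> UNIV \<rightarrow> I"
  by (auto simp: left_shift_def)

lemma coding_left_shift:
  assumes "u \<in> UNIV \<rightarrow> I"
  shows "coding u = f (u 0) (coding (left_shift u))"
proof (rule coding_equality[OF assms])
  fix n :: nat assume "n \<ge> 1"
  then obtain m where "n = Suc m" by (cases n) auto
  moreover have "coding (left_shift u) \<in> words (left_shift u) m ` X"
    using coding_mem_words_image left_shift_mem assms by blast
  ultimately show "f (u 0) (coding (left_shift u)) \<in> words u n ` X"
    by (auto simp: words_Suc_left simp del: word_map.simps)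
qed

section \<open>Compact images of products\<close>

text \<open>
  The index type carries no topology, so each factor is given the discrete topology explicitly.
  The codes that agree with a given one at the first \<open>n\<close> positions form an open set, whose image has
  diameter at most \<open>c ^ n * diameter X\<close>.
\<close>

lemma continuous_map_coding:
  assumes "\<And>j. A j \<subseteq> I"
  shows "continuous_map (product_topology (\<lambda>j. discrete_topology (A j)) UNIV) euclidean coding"
    (is "continuous_map ?T _ _")
proof -
  have topspace: "topspace ?T = Pi UNIV A" by (simp add: PiE_UNIV_domain)
  have "openin ?T {u \<in> topspace ?T. coding u \<in> U}" if "open U" for U
  proof (subst openin_subopen, intro ballI)
    fix u assume "u \<in> {u \<in> topspace ?T. coding u \<in> U}"
    then have u: "\<And>j. u j \<in> A j" and "coding u \<in> U" by (auto simp: topspace)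
    then obtain e where e: "e > 0" "ball (coding u) e \<subseteq> U"
      using \<open>open U\<close> open_contains_ball by blast
    obtain n where n: "c ^ n * diameter X < e"
      using order_tendstoD(2)[OF cylinder_diameter_tendsto_0 e(1)]
      by (auto simp: eventually_sequentially)
    \<comment> \<open>the cylinder of the codes that agree with \<open>u\<close> at the first \<open>n\<close> positions\<close>
    define T where "T = Pi UNIV (\<lambda>j. if j < n then {u j} else A j)"
    have "{j. (if j < n then {u j} else A j) \<noteq> topspace (discrete_topology (A j))} \<subseteq> {..<n}"
      by auto
    then have "openin ?T T"
      unfolding T_def PiE_UNIV_domain[symmetric] using u
      by (intro product_topology_basis) (auto intro: finite_subset)
    moreover have "u \<in> T" using u by (auto simp: T_def)
    moreover have "T \<subseteq> {u \<in> topspace ?T. coding u \<in> U}"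
    proof
      fix v assume v: "v \<in> T"
      have vA: "v j \<in> A j" for j
      proof -
        have "v j \<in> (if j < n then {u j} else A j)" using v by (auto simp: T_def Pi_iff)
        then show ?thesis using u[of j] by (auto split: if_splits)
      qed
      have agree: "u j = v j" if "j < n" for j
      proof -
        have "v j \<in> (if j < n then {u j} else A j)" using v by (auto simp: T_def Pi_iff)
        then show ?thesis using that by simp
      qed
      have I: "u \<in> UNIV \<rightarrow> I" "v \<in> UNIV \<rightarrow> I" using u vA assms by blast+
      have "dist (coding u) (coding v) \<le> c ^ n * diameter X"
        using coding_mem_words_image[OF I(1), of n] coding_mem_words_image[OF I(2), of n]
          words_cong[of n u v] agree
        by (intro dist_words_image[OF I(1)]) auto
      then show "v \<in> {u \<in> topspace ?T. coding u \<in> U}"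
        using n e(2) vA by (auto simp: topspace)
    qed
    ultimately show "\<exists>T. openin ?T T \<and> u \<in> T \<and> T \<subseteq> {u \<in> topspace ?T. coding u \<in> U}" by blast
  qed
  then show ?thesis by (auto simp: continuous_map_def)
qed

lemma compact_coding_image:
  assumes "\<And>j. A j \<subseteq> I"
  shows "compact (coding ` Pi UNIV A)"
proof -
  let ?T = "product_topology (\<lambda>j. discrete_topology (A j)) (UNIV :: nat set)"
  have "compact_space ?T"
    using assms finite_I
    by (auto simp: compact_space_product_topology compact_space_discrete_topology
        intro: finite_subset)
  then have "compactin ?T (Pi UNIV A)"
    by (simp add: compact_space_def PiE_UNIV_domain)
  from image_compactin[OF this continuous_map_coding[OF assms]] show ?thesis by simp
qed

lemma totally_disconnected_if_inj:
  assumes A: "\<And>j. A j \<subseteq> I" and inj: "inj_on coding (Pi UNIV A)"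
  shows "totally_disconnected (coding ` Pi UNIV A)"
proof -
  have "x = y" if S: "connected S" "S \<subseteq> coding ` Pi UNIV A" "x \<in> S" "y \<in> S" for S x y
  proof (rule ccontr)
    assume "x \<noteq> y"
    obtain u v where u: "u \<in> Pi UNIV A" "x = coding u" and v: "v \<in> Pi UNIV A" "y = coding v"
      using S by blast
    with \<open>x \<noteq> y\<close> have "u \<noteq> v" by blast
    then obtain n where n: "u n \<noteq> v n" by (auto simp: fun_eq_iff)
    define K where "K = Pi UNIV (A(n := {u n}))"
    define L where "L = Pi UNIV (A(n := A n - {u n}))"
    have "u n \<in> A n" using u(1) by auto
    then have K: "K = {w \<in> Pi UNIV A. w n = u n}" and L: "L = {w \<in> Pi UNIV A. w n \<noteq> u n}"
      by (auto simp: K_def L_def Pi_iff split: if_splits)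
    have "compact (coding ` K)" "compact (coding ` L)"
      unfolding K_def L_def using A \<open>u n \<in> A n\<close>
      by (auto intro!: compact_coding_image split: if_splits) (meson subsetD)+
    then have "closed (coding ` K)" "closed (coding ` L)" by (auto intro: compact_imp_closed)
    moreover have "coding ` K \<inter> coding ` L \<inter> S = {}"
      using inj by (auto simp: K L dest: inj_onD)
    moreover have "S \<subseteq> coding ` K \<union> coding ` L" using S(2) by (auto simp: K L)
    ultimately have "coding ` K \<inter> S = {} \<or> coding ` L \<inter> S = {}"
      using connected_closedD[OF S(1)] by blast
    moreover have "x \<in> coding ` K" "y \<in> coding ` L" using u v n by (auto simp: K L)
    ultimately show False using S(3,4) by blast
  qed
  then have "y = x" if "connected_component (coding ` Pi UNIV A) x y" for x y
    using that unfolding connected_component_def by metis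
  then show ?thesis
    unfolding totally_disconnected_def using connected_component_refl by fastforce
qed

section \<open>Injectivity away from post-critical codes\<close>

text \<open>
  At the first position \<open>n\<close> where two codes of the same point differ, the common point of the
  shifted codes would be critical.
\<close>

lemma coding_inj_on_if_avoids_post_critical:
  assumes inj: "\<And>i. i \<in> I \<Longrightarrow> inj_on (f i) X"
    and A: "\<And>j. A j \<subseteq> I"
    and avoid: "\<And>k p. p \<in> post_critical_set X I f \<Longrightarrow> \<exists>j. p j \<notin> A (j + k)"
  shows "inj_on coding (Pi UNIV A)"
proof (rule inj_onI)
  fix u v assume u: "u \<in> Pi UNIV A" and v: "v \<in> Pi UNIV A" and uv: "coding u = coding v"
  note shift = funpow_left_shift
  have mem: "(left_shift ^^ n) u \<in> UNIV \<rightarrow> I" "(left_shift ^^ n) v \<in> UNIV \<rightarrow> I" for n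
    using u v A by (auto simp: shift Pi_iff)
  have expand: "coding ((left_shift ^^ n) w) = f (w n) (coding ((left_shift ^^ Suc n) w))"
    if "(left_shift ^^ n) w \<in> UNIV \<rightarrow> I" for n w
    using coding_left_shift[OF that] by (simp add: funpow_left_shift[of n w 0])
  let ?J = "limit_set X (\<lambda>_. I) (\<lambda>_. f)"
  have J: "coding w \<in> ?J" if "w \<in> UNIV \<rightarrow> I" for w
    using that by (auto simp: limit_set_def)
  \<comment> \<open>Shifted codes of the same point start with the same index: otherwise the point is critical.\<close>
  have step: "u n = v n"
    if eq: "coding ((left_shift ^^ n) u) = coding ((left_shift ^^ n) v)" for n
  proof (rule ccontr)
    assume ne: "u n \<noteq> v n"
    let ?a = "coding ((left_shift ^^ n) u)"
    have "?a = f (u n) (coding ((left_shift ^^ Suc n) u))"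
      "?a = f (v n) (coding ((left_shift ^^ Suc n) v))"
      using expand[OF mem(1)] expand[OF mem(2)] eq by metis+
    then have "?a \<in> f (u n) ` ?J" "?a \<in> f (v n) ` ?J"
      using J[OF mem(1)[of "Suc n"]] J[OF mem(2)[of "Suc n"]] by blast+
    moreover have "u n \<in> I" using Pi_mem[OF u, of n] A by auto
    moreover have "v n \<in> I - {u n}" using Pi_mem[OF v, of n] A ne by auto
    ultimately have "?a \<in> critical_set X I f"
      unfolding critical_set_def Let_def by (intro UN_I IntI)
    then have "(left_shift ^^ 1) ((left_shift ^^ n) u) \<in> post_critical_set X I f"
      unfolding post_critical_set_def using mem(1)[of n] by (intro UN_I imageI) auto
    then obtain j where "(left_shift ^^ Suc n) u j \<notin> A (j + Suc n)"
      using avoid[of "(left_shift ^^ Suc n) u" "Suc n"] by auto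
    then show False using u by (auto simp only: shift)
  qed
  have "coding ((left_shift ^^ n) u) = coding ((left_shift ^^ n) v)" for n
  proof (induction n)
    case (Suc n)
    have "f (u n) (coding ((left_shift ^^ Suc n) u)) = f (u n) (coding ((left_shift ^^ Suc n) v))"
      using expand[OF mem(1)] expand[OF mem(2)] Suc step[OF Suc] by metis
    moreover have "u n \<in> I" using Pi_mem[OF u, of n] A by auto
    ultimately show ?case
      using inj_onD[OF inj] coding_mem[OF mem(1)] coding_mem[OF mem(2)] by blast
  qed (simp add: uv)
  then show "u = v" using step by blast
qed

end

lemma post_critical_set_subset: "post_critical_set X I f \<subseteq> UNIV \<rightarrow> I"
  by (auto simp: post_critical_set_def Pi_iff funpow_left_shift)

section \<open>Almost sure exit of independent variables\<close>

lemma (in prob_space) AE_indep_vars_exit: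
  assumes indep: "indep_vars (\<lambda>_. N) R (UNIV :: nat set)"
    and distr: "\<And>j. distr M N (R j) = N"
    and A: "\<And>j. A j \<in> sets N" and q: "\<And>j. measure N (A j) \<le> q" "q < 1"
  shows "AE \<omega> in M. \<exists>j. R (j + k) \<omega> \<notin> A j"
proof -
  have R[measurable]: "R j \<in> measurable M N" for j
    using indep by (auto simp: indep_vars_def2)
  \<comment> \<open>Only indices \<open>i \<ge> k\<close> matter, so the truncated difference is harmless.\<close>
  define B where "B i = R i -` A (i - k) \<inter> space M" for i
  have B[measurable]: "B i \<in> events" for i
    unfolding B_def using R A by (rule measurable_sets)
  have prob_B: "prob (B i) \<le> q" for i
    using q(1)[of "i - k"] measure_distr[OF R A, of i "i - k"] distr by (simp add: B_def)
  have q0: "0 \<le> q" using q(1)[of 0] measure_nonneg order_trans by blast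
  let ?E = "\<Inter>i\<in>{k..}. B i"
  have "prob ?E \<le> q ^ n" if "n \<ge> 1" for n
  proof -
    have "?E \<subseteq> (\<Inter>i\<in>{k..<k+n}. B i)" by auto
    moreover have "(\<Inter>i\<in>{k..<k+n}. B i) \<in> events" using that by (intro sets.finite_INT) auto
    ultimately have "prob ?E \<le> prob (\<Inter>i\<in>{k..<k+n}. B i)" by (rule finite_measure_mono)
    also have "\<dots> = (\<Prod>i\<in>{k..<k+n}. prob (B i))"
      using indep that A
      by (intro indep_setsD[of "\<lambda>i. {R i -` A \<inter> space M |A. A \<in> sets N}" UNIV])
        (auto simp: indep_vars_def2 B_def)
    also have "\<dots> \<le> (\<Prod>i\<in>{k..<k+n}. q)"
      using prob_B by (intro prod_mono) auto
    finally show ?thesis by simp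
  qed
  moreover have "(\<lambda>n. q ^ n) \<longlonglongrightarrow> 0" using q0 q(2) by (intro LIMSEQ_power_zero) auto
  ultimately have "prob ?E \<le> 0" using LIMSEQ_le_const by blast
  then have "prob ?E = 0" using measure_nonneg[of M ?E] by linarith
  moreover have "?E \<in> events" by (intro sets.countable_INT') auto
  ultimately have "?E \<in> null_sets M" by (simp add: null_sets_def emeasure_eq_measure)
  then have "AE \<omega> in M. \<omega> \<notin> ?E" by (rule AE_not_in)
  then show ?thesis
  proof (rule AE_mp, intro AE_I2 impI)
    fix \<omega> assume "\<omega> \<in> space M" "\<omega> \<notin> ?E"
    then obtain i where "k \<le> i" "R i \<omega> \<notin> A (i - k)" by (auto simp: B_def)
    then show "\<exists>j. R (j + k) \<omega> \<notin> A j" by (intro exI[of _ "i - k"]) simp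
  qed
qed

section \<open>Total disconnectedness of the random limit set\<close>

theorem theorem1:
  fixes X :: "'a::metric_space set" and I :: "'i set" and f :: "'i \<Rightarrow> 'a \<Rightarrow> 'a"
    and \<mu> :: "'i set measure" and M :: "'w measure" and R :: "nat \<Rightarrow> 'w \<Rightarrow> 'i set"
  assumes "compact X" and "X \<noteq> {}"
    and "autonomous_ifs X I f"
    and "post_critically_countable X I f"
    and "\<And>i. i \<in> I \<Longrightarrow> inj_on (f i) X"
    and "prob_space \<mu>"
    and "sets \<mu> = sets (count_space (Pow I - {{}}))"
    and "\<And>i. i \<in> I \<Longrightarrow> measure \<mu> {I' \<in> Pow I - {{}}. i \<notin> I'} > 0"
    and "prob_space M"
    and "prob_space.indep_vars M (\<lambda>_. \<mu>) R UNIV"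
    and "\<And>j. distr M \<mu> (R j) = \<mu>"
  shows "AE \<omega> in M. totally_disconnected (limit_set X (\<lambda>j. R j \<omega>) (\<lambda>_. f))"
proof -
  interpret M: prob_space M by fact
  interpret \<mu>: prob_space \<mu> by fact
  have I: "finite I" "I \<noteq> {}"
    using assms(3) by (auto simp: autonomous_ifs_def nonautonomous_ifs_def)
  obtain c where "c < 1" "\<And>i. i \<in> I \<Longrightarrow> c-lipschitz_on X (f i)"
    using assms(3) by (auto simp: autonomous_ifs_def nonautonomous_ifs_def)
  moreover have "f i \<in> X \<rightarrow> X" if "i \<in> I" for i
    using assms(3) that by (auto simp: autonomous_ifs_def nonautonomous_ifs_def)
  moreover have "0 \<le> c"
    using I(2) calculation(2) lipschitz_on_nonneg by blast
  ultimately interpret contracting_ifs X I f c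
    using assms(1,2) I(1) by unfold_locales
  have space_\<mu>: "space \<mu> = Pow I - {{}}"
    using sets_eq_imp_space_eq[OF assms(7)] by simp
  \<comment> \<open>the event that a random set contains \<open>i\<close>; its probability is at most \<open>q < 1\<close> for \<open>i \<in> I\<close>\<close>
  define A where "A i = {I' \<in> Pow I - {{}}. i \<in> I'}" for i
  have A_sets: "A i \<in> sets \<mu>" for i
    by (auto simp: assms(7) A_def)
  define q where "q = Max ((\<lambda>i. measure \<mu> (A i)) ` I)"
  have A_less: "measure \<mu> (A i) < 1" if "i \<in> I" for i
  proof -
    have "space \<mu> - A i = {I' \<in> Pow I - {{}}. i \<notin> I'}" by (auto simp: space_\<mu> A_def)
    then have "1 - measure \<mu> (A i) > 0"
      using assms(8)[OF that] \<mu>.prob_compl[OF A_sets[of i]] by simp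
    then show ?thesis by simp
  qed
  have q: "measure \<mu> (A i) \<le> q" if "i \<in> I" for i
    unfolding q_def using I that by simp
  have "q < 1" unfolding q_def using I A_less by simp
  have "AE \<omega> in M. \<exists>j. R (j + k) \<omega> \<notin> A (p j)" if "p \<in> post_critical_set X I f" for p k
  proof (rule M.AE_indep_vars_exit[OF assms(10,11)])
    fix j
    have "p j \<in> I" using that post_critical_set_subset by blast
    then show "measure \<mu> (A (p j)) \<le> q" by (rule q)
  qed (use A_sets \<open>q < 1\<close> in auto)
  then have "AE \<omega> in M. \<forall>p\<in>post_critical_set X I f. \<forall>k. \<exists>j. R (j + k) \<omega> \<notin> A (p j)"
    using assms(4) by (simp add: AE_ball_countable AE_all_countable post_critically_countable_def)
  then show ?thesis
  proof (rule AE_mp, intro AE_I2 impI)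
    fix \<omega> assume \<omega>: "\<omega> \<in> space M"
      and exit: "\<forall>p\<in>post_critical_set X I f. \<forall>k. \<exists>j. R (j + k) \<omega> \<notin> A (p j)"
    have R: "R j \<omega> \<in> Pow I - {{}}" for j
    proof -
      have "R j \<in> measurable M \<mu>" using assms(10) by (auto simp: M.indep_vars_def2)
      from measurable_space[OF this \<omega>] show ?thesis by (simp add: space_\<mu>)
    qed
    have "inj_on coding (Pi UNIV (\<lambda>j. R j \<omega>))"
    proof (rule coding_inj_on_if_avoids_post_critical[OF assms(5)])
      show "\<exists>j. p j \<notin> R (j + k) \<omega>" if "p \<in> post_critical_set X I f" for k p
        using exit that R by (fastforce simp: A_def)
    qed (use R in auto)
    then show "totally_disconnected (limit_set X (\<lambda>j. R j \<omega>) (\<lambda>_. f))"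
      unfolding limit_set_def using R by (intro totally_disconnected_if_inj) auto
  qed
qed

end
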